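(* Let $T_t=\sum_{i\ge0}t^iT_i$ be a formal one-parameter deformation of an $\mathcal{O}$-operator $T$ on a Hom-associative algebra $(A,\mu,\alpha)$ with respect to a bimodule $(M,l,r,\phi)$. Then the $1$-cochain $T_1\in C^1_{\phi,\alpha}(M,A)$ is a $1$-cocycle with respect to the cohomology of the $\mathcal{O}$-operator $T$, i.e. for all $u,v\in M$, $$T(u)\cdot T_1(v)+T_1(u)\cdot T(v)-T(r(u,T_1(v))+l(T_1(u),v))-T_1(r(u,T(v))+l(T(u),v))=0.$$
   Context: All vector spaces are over a field $\mathbb{K}$. A Hom-associative algebra $(A,\mu,\alpha)$ (always multiplicative) is a vector space $A$ with a bilinear map $\mu$, written $\mu(a,b)=a\cdot b$, and a linear map $\alpha:A\to A$ such that $\alpha(a\cdot b)=\alpha(a)\cdot\alpha(b)$ and $\alpha(a)\cdot(b\cdot c)=(a\cdot b)\cdot\alpha(c)$ for all $a,b,c\in A$. A bimodule $(M,l,r,\phi)$ over $(A,\mu,\alpha)$ is a vector space $M$ with linear maps $\phi:M\to M$, $l:A\otimes M\to M$, $r:M\otimes A\to M$ such that for all $x,y\in A$, $v\in M$: $\phi l(x,v)=l(\alpha(x),\phi(v))$, $\phi r(v,x)=r(\phi(v),\alpha(x))$, $l(x\cdot y,\phi(v))=l(\alpha(x),l(y,v))$, $r(\phi(v),x\cdot y)=r(r(v,x),\alpha(y))$, $l(\alpha(x),r(v,y))=r(l(x,v),\alpha(y))$. An $\mathcal{O}$-operator on $A$ with respect to $M$ is a linear map $T:M\to A$ with $T\phi=\alpha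 T$ and $T(u)\cdot T(v)=T(l(T(u),v)+r(u,T(v)))$ for all $u,v\in M$. $C^1_{\phi,\alpha}(M,A)$ is the space of linear maps $f:M\to A$ with $\alpha f=f\phi$. Extending $\mu,\alpha,l,r,\phi$ $\mathbb{K}[[t]]$-linearly, $A[[t]]$ is a Hom-associative algebra over $\mathbb{K}[[t]]$ and $M[[t]]$ a bimodule over it. A formal one-parameter deformation of $T$ is $T_t=\sum_{i\ge0}t^iT_i$ with $T_0=T$, $T_i\in C^1_{\phi,\alpha}(M,A)$, such that the $\mathbb{K}[[t]]$-linear map $T_t:M[[t]]\to A[[t]]$ is an $\mathcal{O}$-operator on $A[[t]]$ with respect to $M[[t]]$. *)

theory Defs
  imports "HOL-Computational_Algebra.Formal_Power_Series"
begin

unbundle fps_syntax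

section \<open>Hom-associative algebras and bimodules over a commutative ring\<close>

text \<open>
  The ground ring is only required to be commutative, since the same notions are needed over a
  field \<open>K\<close> and over \<open>K[[t]]\<close>. Over a field, \<^const>\<open>module\<close> and \<^const>\<open>vector_space\<close> coincide
  (\<open>module_iff_vector_space\<close>). Linear maps out of a tensor product are given as curried bilinear maps.
\<close>

definition bilinear_map ::
  "('k::comm_ring_1 \<Rightarrow> 'u::ab_group_add \<Rightarrow> 'u) \<Rightarrow> ('k \<Rightarrow> 'v::ab_group_add \<Rightarrow> 'v)
    \<Rightarrow> ('k \<Rightarrow> 'w::ab_group_add \<Rightarrow> 'w) \<Rightarrow> ('u \<Rightarrow> 'v \<Rightarrow> 'w) \<Rightarrow> bool"
  where "bilinear_map sU sV sW \<beta> \<longleftrightarrow>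
    (\<forall>x. module_hom sV sW (\<beta> x)) \<and> (\<forall>y. module_hom sU sW (\<lambda>x. \<beta> x y))"

definition hom_associative_algebra ::
  "('k::comm_ring_1 \<Rightarrow> 'a::ab_group_add \<Rightarrow> 'a) \<Rightarrow> ('a \<Rightarrow> 'a \<Rightarrow> 'a) \<Rightarrow> ('a \<Rightarrow> 'a) \<Rightarrow> bool"
  where "hom_associative_algebra sA \<mu> \<alpha> \<longleftrightarrow>
    module sA \<and> bilinear_map sA sA sA \<mu> \<and> module_hom sA sA \<alpha> \<and>
    (\<forall>a b. \<alpha> (\<mu> a b) = \<mu> (\<alpha> a) (\<alpha> b)) \<and>
    (\<forall>a b c. \<mu> (\<alpha> a) (\<mu> b c) = \<mu> (\<mu> a b) (\<alpha> c))"

definition hom_bimodule ::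
  "('k::comm_ring_1 \<Rightarrow> 'a::ab_group_add \<Rightarrow> 'a) \<Rightarrow> ('a \<Rightarrow> 'a \<Rightarrow> 'a) \<Rightarrow> ('a \<Rightarrow> 'a)
    \<Rightarrow> ('k \<Rightarrow> 'm::ab_group_add \<Rightarrow> 'm) \<Rightarrow> ('a \<Rightarrow> 'm \<Rightarrow> 'm) \<Rightarrow> ('m \<Rightarrow> 'a \<Rightarrow> 'm) \<Rightarrow> ('m \<Rightarrow> 'm) \<Rightarrow> bool"
  where "hom_bimodule sA \<mu> \<alpha> sM l r \<phi> \<longleftrightarrow>
    module sM \<and> module_hom sM sM \<phi> \<and> bilinear_map sA sM sM l \<and> bilinear_map sM sA sM r \<and>
    (\<forall>x v. \<phi> (l x v) = l (\<alpha> x) (\<phi> v)) \<and>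
    (\<forall>x v. \<phi> (r v x) = r (\<phi> v) (\<alpha> x)) \<and>
    (\<forall>x y v. l (\<mu> x y) (\<phi> v) = l (\<alpha> x) (l y v)) \<and>
    (\<forall>x y v. r (\<phi> v) (\<mu> x y) = r (r v x) (\<alpha> y)) \<and>
    (\<forall>x y v. l (\<alpha> x) (r v y) = r (l x v) (\<alpha> y))"


section \<open>O-operators and their 1-cocycles\<close>

text \<open>The space \<open>C\<^sup>1\<^bsub>\<phi>,\<alpha>\<^esub>(M, A)\<close>.\<close>

definition cochains1 ::
  "('k::comm_ring_1 \<Rightarrow> 'a::ab_group_add \<Rightarrow> 'a) \<Rightarrow> ('a \<Rightarrow> 'a)
    \<Rightarrow> ('k \<Rightarrow> 'm::ab_group_add \<Rightarrow> 'm) \<Rightarrow> ('m \<Rightarrow> 'm) \<Rightarrow> ('m \<Rightarrow> 'a) set"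
  where "cochains1 sA \<alpha> sM \<phi> = {f. module_hom sM sA f \<and> (\<forall>u. \<alpha> (f u) = f (\<phi> u))}"

definition O_operator ::
  "('k::comm_ring_1 \<Rightarrow> 'a::ab_group_add \<Rightarrow> 'a) \<Rightarrow> ('a \<Rightarrow> 'a \<Rightarrow> 'a) \<Rightarrow> ('a \<Rightarrow> 'a)
    \<Rightarrow> ('k \<Rightarrow> 'm::ab_group_add \<Rightarrow> 'm) \<Rightarrow> ('a \<Rightarrow> 'm \<Rightarrow> 'm) \<Rightarrow> ('m \<Rightarrow> 'a \<Rightarrow> 'm) \<Rightarrow> ('m \<Rightarrow> 'm)
    \<Rightarrow> ('m \<Rightarrow> 'a) \<Rightarrow> bool"
  where "O_operator sA \<mu> \<alpha> sM l r \<phi> T \<longleftrightarrow>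
    module_hom sM sA T \<and> (\<forall>u. T (\<phi> u) = \<alpha> (T u)) \<and>
    (\<forall>u v. \<mu> (T u) (T v) = T (l (T u) v + r u (T v)))"

text \<open>
  An O-operator \<open>T\<close> makes \<open>M\<close> a Hom-associative algebra with product
  \<open>u \<star> v = l(T u, v) + r(u, T v)\<close>, and \<open>A\<close> a bimodule over it with the actions below. The cohomology of
  \<open>T\<close> is the Hochschild cohomology of \<open>(M, \<star>, \<phi>)\<close> with coefficients in \<open>A\<close>; in degree 1 its
  differential is \<open>(\<delta> f)(u, v) = u \<cdot> f(v) - f(u \<star> v) + f(u) \<cdot> v\<close>, without twisting maps.
\<close>

definition induced_product ::
  "('a \<Rightarrow> 'm \<Rightarrow> 'm) \<Rightarrow> ('m \<Rightarrow> 'a \<Rightarrow> 'm) \<Rightarrow> ('m \<Rightarrow> 'a) \<Rightarrow> 'm \<Rightarrow> 'm \<Rightarrow> 'm::ab_group_add"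
  where "induced_product l r T u v = l (T u) v + r u (T v)"

definition induced_left ::
  "('a \<Rightarrow> 'a \<Rightarrow> 'a) \<Rightarrow> ('m \<Rightarrow> 'a \<Rightarrow> 'm) \<Rightarrow> ('m \<Rightarrow> 'a) \<Rightarrow> 'm \<Rightarrow> 'a \<Rightarrow> 'a::ab_group_add"
  where "induced_left \<mu> r T u a = \<mu> (T u) a - T (r u a)"

definition induced_right ::
  "('a \<Rightarrow> 'a \<Rightarrow> 'a) \<Rightarrow> ('a \<Rightarrow> 'm \<Rightarrow> 'm) \<Rightarrow> ('m \<Rightarrow> 'a) \<Rightarrow> 'a \<Rightarrow> 'm \<Rightarrow> 'a::ab_group_add"
  where "induced_right \<mu> l T a u = \<mu> a (T u) - T (l a u)"

definition O_coboundary1 ::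
  "('a::ab_group_add \<Rightarrow> 'a \<Rightarrow> 'a) \<Rightarrow> ('a \<Rightarrow> 'm \<Rightarrow> 'm) \<Rightarrow> ('m \<Rightarrow> 'a \<Rightarrow> 'm) \<Rightarrow> ('m \<Rightarrow> 'a)
    \<Rightarrow> ('m \<Rightarrow> 'a) \<Rightarrow> 'm::ab_group_add \<Rightarrow> 'm \<Rightarrow> 'a"
  where "O_coboundary1 \<mu> l r T f u v =
    induced_left \<mu> r T u (f v) - f (induced_product l r T u v) + induced_right \<mu> l T (f u) v"

definition O_cocycle1 ::
  "('k::comm_ring_1 \<Rightarrow> 'a::ab_group_add \<Rightarrow> 'a) \<Rightarrow> ('a \<Rightarrow> 'a \<Rightarrow> 'a) \<Rightarrow> ('a \<Rightarrow> 'a)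
    \<Rightarrow> ('k \<Rightarrow> 'm::ab_group_add \<Rightarrow> 'm) \<Rightarrow> ('a \<Rightarrow> 'm \<Rightarrow> 'm) \<Rightarrow> ('m \<Rightarrow> 'a \<Rightarrow> 'm) \<Rightarrow> ('m \<Rightarrow> 'm)
    \<Rightarrow> ('m \<Rightarrow> 'a) \<Rightarrow> ('m \<Rightarrow> 'a) \<Rightarrow> bool"
  where "O_cocycle1 sA \<mu> \<alpha> sM l r \<phi> T f \<longleftrightarrow>
    f \<in> cochains1 sA \<alpha> sM \<phi> \<and> (\<forall>u v. O_coboundary1 \<mu> l r T f u v = 0)"


section \<open>Extension to formal power series\<close>

text \<open>
  \<open>A[[t]]\<close> is the type \<open>'a fps\<close> of sequences in \<open>A\<close>, with addition defined coefficientwise. For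
  bilinear \<open>\<beta>\<close>, \<open>fps_bilinear \<beta>\<close> is the extension
  \<open>(\<Sum> t\<^sup>i a\<^sub>i, \<Sum> t\<^sup>j b\<^sub>j) \<mapsto> \<Sum> t\<^sup>i\<^sup>+\<^sup>j \<beta>(a\<^sub>i, b\<^sub>j)\<close>; for \<open>\<beta>\<close> the multiplication of \<open>K\<close> this is the product of \<open>K[[t]]\<close>,
  and for \<open>\<beta>\<close> the scalar multiplication of \<open>A\<close> it is that of the \<open>K[[t]]\<close>-module \<open>A[[t]]\<close>.
\<close>

definition fps_bilinear ::
  "('u::zero \<Rightarrow> 'v::zero \<Rightarrow> 'w::comm_monoid_add) \<Rightarrow> 'u fps \<Rightarrow> 'v fps \<Rightarrow> 'w fps"
  where "fps_bilinear \<beta> a b = Abs_fps (\<lambda>n. \<Sum>i=0..n. \<beta> (a $ i) (b $ (n - i)))"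

definition fps_linear :: "('u::zero \<Rightarrow> 'v::zero) \<Rightarrow> 'u fps \<Rightarrow> 'v fps"
  where "fps_linear f a = Abs_fps (\<lambda>n. f (a $ n))"

text \<open>
  The map \<open>\<Sum> t\<^sup>i T\<^sub>i\<close>, extended to \<open>M[[t]] \<rightarrow> A[[t]]\<close>.
\<close>

definition fps_family :: "(nat \<Rightarrow> 'm::zero \<Rightarrow> 'a::comm_monoid_add) \<Rightarrow> 'm fps \<Rightarrow> 'a fps"
  where "fps_family T v = Abs_fps (\<lambda>n. \<Sum>i=0..n. T i (v $ (n - i)))"

definition formal_deformation ::
  "('k::comm_ring_1 \<Rightarrow> 'a::ab_group_add \<Rightarrow> 'a) \<Rightarrow> ('a \<Rightarrow> 'a \<Rightarrow> 'a) \<Rightarrow> ('a \<Rightarrow> 'a)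
    \<Rightarrow> ('k \<Rightarrow> 'm::ab_group_add \<Rightarrow> 'm) \<Rightarrow> ('a \<Rightarrow> 'm \<Rightarrow> 'm) \<Rightarrow> ('m \<Rightarrow> 'a \<Rightarrow> 'm) \<Rightarrow> ('m \<Rightarrow> 'm)
    \<Rightarrow> ('m \<Rightarrow> 'a) \<Rightarrow> (nat \<Rightarrow> 'm \<Rightarrow> 'a) \<Rightarrow> bool"
  where "formal_deformation sA \<mu> \<alpha> sM l r \<phi> T Ti \<longleftrightarrow>
    Ti 0 = T \<and> (\<forall>i. Ti i \<in> cochains1 sA \<alpha> sM \<phi>) \<and>
    O_operator (fps_bilinear sA) (fps_bilinear \<mu>) (fps_linear \<alpha>)
      (fps_bilinear sM) (fps_bilinear l) (fps_bilinear r) (fps_linear \<phi>) (fps_family Ti)"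


subsection \<open>The extended structures\<close>

lemma fps_bilinear_times: "fps_bilinear (*) a b = a * (b :: 'k::comm_ring_1 fps)"
  by (simp add: fps_bilinear_def fps_eq_iff fps_mult_nth)

lemma fps_bilinear_assoc:
  assumes "\<And>x y z. P (Q x y) z = R x (S y z)"
    and "\<And>z. Modules.additive (\<lambda>x. P x z)" and "\<And>x. Modules.additive (R x)"
  shows "fps_bilinear P (fps_bilinear Q a b) c = fps_bilinear R a (fps_bilinear S b c)"
proof (rule fps_ext)
  fix n
  have "(\<Sum>j=0..n. \<Sum>i=0..j. P (Q (a$i) (b$(j - i))) (c$(n - j))) =
        (\<Sum>j=0..n. \<Sum>i=0..n - j. P (Q (a$j) (b$i)) (c$(n - j - i)))"
    by (rule fps_mult_assoc_lemma)
  then show "fps_bilinear P (fps_bilinear Q a b) c $ n = fps_bilinear R a (fps_bilinear S b c) $ n"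
    by (simp add: fps_bilinear_def additive.sum[OF assms(2)] additive.sum[OF assms(3)] assms(1))
qed

lemma fps_bilinear_flip: "fps_bilinear \<beta> a b = fps_bilinear (\<lambda>y x. \<beta> x y) b a"
  unfolding fps_bilinear_def fps_eq_iff
  by (simp add: fps_mult_commute_lemma[where f = "\<lambda>i j. \<beta> (a $ i) (b $ j)"])

lemma fps_bilinear_linear1:
  "fps_bilinear \<beta> (fps_linear f a) b = fps_bilinear (\<lambda>x. \<beta> (f x)) a b"
  by (simp add: fps_bilinear_def fps_linear_def)

lemma fps_bilinear_linear2:
  "fps_bilinear \<beta> a (fps_linear f b) = fps_bilinear (\<lambda>x y. \<beta> x (f y)) a b"
  by (simp add: fps_bilinear_def fps_linear_def)

lemma fps_linear_bilinear:
  assumes "Modules.additive f"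
  shows "fps_linear f (fps_bilinear \<beta> a b) = fps_bilinear (\<lambda>x y. f (\<beta> x y)) a b"
  by (simp add: fps_bilinear_def fps_linear_def additive.sum[OF assms])

lemma fps_bilinear_add_right:
  "(\<And>x. Modules.additive (\<beta> x)) \<Longrightarrow>
    fps_bilinear \<beta> a (b + b') = fps_bilinear \<beta> a b + fps_bilinear \<beta> a b'"
  by (simp add: fps_bilinear_def fps_eq_iff additive.add sum.distrib)

lemma fps_bilinear_add_left:
  "(\<And>y. Modules.additive (\<lambda>x. \<beta> x y)) \<Longrightarrow>
    fps_bilinear \<beta> (a + a') b = fps_bilinear \<beta> a b + fps_bilinear \<beta> a' b"
  by (simp add: fps_bilinear_def fps_eq_iff additive.add[of "\<lambda>x. \<beta> x _"] sum.distrib)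

lemma additive_module_hom: "module_hom s1 s2 f \<Longrightarrow> Modules.additive f"
  by (simp add: Modules.additive_def module_hom.add)

lemma additive_scale:
  assumes "module s"
  shows "Modules.additive (s c)" and "Modules.additive (\<lambda>c. s c x)"
  using assms
  by (simp_all add: Modules.additive_def module.scale_right_distrib module.scale_left_distrib)

lemma additive_bilinear_map:
  assumes "bilinear_map sU sV sW \<beta>"
  shows "Modules.additive (\<beta> x)" and "Modules.additive (\<lambda>x. \<beta> x y)"
  using assms by (auto simp: bilinear_map_def dest: additive_module_hom)

lemma module_fps:
  assumes "module s"
  shows "module (fps_bilinear s)"
proof
  note add = additive_scale[OF assms]
  fix c d :: "'a fps" and x y :: "'b fps"
  show "fps_bilinear s c (x + y) = fps_bilinear s c x + fps_bilinear s c y"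
    by (rule fps_bilinear_add_right) (rule add)
  show "fps_bilinear s (c + d) x = fps_bilinear s c x + fps_bilinear s d x"
    by (rule fps_bilinear_add_left) (rule add)
  have "fps_bilinear s (fps_bilinear (*) c d) x = fps_bilinear s c (fps_bilinear s d x)"
    by (rule fps_bilinear_assoc) (simp_all add: add module.scale_scale[OF assms])
  then show "fps_bilinear s c (fps_bilinear s d x) = fps_bilinear s (c * d) x"
    by (simp add: fps_bilinear_times)
  have "(\<Sum>i=0..n. s (1 $ i) (x $ (n - i))) = x $ n" for n
  proof -
    have "(\<Sum>i=0..n. s (1 $ i) (x $ (n - i))) = (\<Sum>i=0..n. if i = 0 then x $ n else 0)"
      by (rule sum.cong) (auto simp: module.scale_one[OF assms] module.scale_zero_left[OF assms])
    then show ?thesis by simp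
  qed
  then show "fps_bilinear s 1 x = x"
    by (simp add: fps_bilinear_def fps_eq_iff)
qed

lemma fps_linear_module_hom:
  assumes "module_hom sU sV f"
  shows "module_hom (fps_bilinear sU) (fps_bilinear sV) (fps_linear f)"
proof -
  interpret module_hom sU sV f by fact
  note add = additive_module_hom[OF assms]
  show ?thesis
    unfolding module_hom_iff
    by (simp add: module_fps m1.module_axioms m2.module_axioms fps_linear_bilinear[OF add]
        fps_bilinear_linear2 scale)
       (simp add: fps_linear_def fps_eq_iff additive.add[OF add])
qed

lemma fps_bilinear_bilinear_map:
  assumes \<beta>: "bilinear_map sU sV sW \<beta>"
  shows "bilinear_map (fps_bilinear sU) (fps_bilinear sV) (fps_bilinear sW) (fps_bilinear \<beta>)"
proof -
  have mods: "module sU" "module sV" "module sW"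
    and s1: "\<And>c x y. \<beta> (sU c x) y = sW c (\<beta> x y)" and s2: "\<And>c x y. \<beta> x (sV c y) = sW c (\<beta> x y)"
    using \<beta> by (auto simp: bilinear_map_def module_hom_iff)
  note add = additive_bilinear_map[OF \<beta>] additive_scale[OF mods(3)]
  have A: "fps_bilinear \<beta> (fps_bilinear sU c a) b = fps_bilinear sW c (fps_bilinear \<beta> a b)" for c a b
    by (rule fps_bilinear_assoc) (simp_all add: s1 add)
  have B: "fps_bilinear \<beta> a (fps_bilinear sV c b) = fps_bilinear sW c (fps_bilinear \<beta> a b)" for c a b
    unfolding fps_bilinear_flip[of \<beta>]
    by (rule fps_bilinear_assoc) (simp_all add: s2 add)
  show ?thesis
    unfolding bilinear_map_def module_hom_iff
    by (auto simp: module_fps mods A B fps_bilinear_add_left fps_bilinear_add_right add)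
qed

lemma fps_family_module_hom:
  assumes "\<And>i. module_hom sM sA (Ti i)"
  shows "module_hom (fps_bilinear sM) (fps_bilinear sA) (fps_family Ti)"
proof -
  have mods: "module sM" "module sA" and sc: "\<And>i c x. Ti i (sM c x) = sA c (Ti i x)"
    using assms by (auto simp: module_hom_iff)
  note add = additive_module_hom[OF assms]
  have "fps_family Ti (fps_bilinear sM c x) $ n = fps_bilinear sA c (fps_family Ti x) $ n" for c x n
  proof -
    have "fps_family Ti (fps_bilinear sM c x) $ n =
        (\<Sum>i=0..n. \<Sum>j=0..n - i. Ti i (sM (c $ j) (x $ (n - i - j))))"
      by (simp add: fps_family_def fps_bilinear_def additive.sum[OF add])
    also have "\<dots> = (\<Sum>k=0..n. \<Sum>i=0..k. Ti i (sM (c $ (k - i)) (x $ (n - k))))"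
      by (rule fps_mult_assoc_lemma[symmetric])
    also have "\<dots> = (\<Sum>k=0..n. \<Sum>j=0..k. Ti (k - j) (sM (c $ j) (x $ (n - k))))"
      using fps_mult_commute_lemma[where f = "\<lambda>i j. Ti i (sM (c $ j) (x $ (n - k)))" for k]
      by simp
    also have "\<dots> = (\<Sum>j=0..n. \<Sum>i=0..n - j. Ti i (sM (c $ j) (x $ (n - j - i))))"
      by (rule fps_mult_assoc_lemma[where f = "\<lambda>j i m. Ti i (sM (c $ j) (x $ m))"])
    also have "\<dots> = fps_bilinear sA c (fps_family Ti x) $ n"
      by (simp add: fps_family_def fps_bilinear_def sc additive.sum[OF additive_scale(1)[OF mods(2)]])
    finally show ?thesis .
  qed
  then show ?thesis
    unfolding module_hom_iff
    by (auto simp: module_fps mods fps_eq_iff)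
       (simp add: fps_family_def additive.add[OF add] sum.distrib)
qed

lemma hom_associative_algebra_fps:
  assumes "hom_associative_algebra sA \<mu> \<alpha>"
  shows "hom_associative_algebra (fps_bilinear sA) (fps_bilinear \<mu>) (fps_linear \<alpha>)"
proof -
  have \<mu>: "bilinear_map sA sA sA \<mu>" and \<alpha>: "module_hom sA sA \<alpha>" and m: "module sA"
    and mult: "\<And>a b. \<alpha> (\<mu> a b) = \<mu> (\<alpha> a) (\<alpha> b)"
    and assoc: "\<And>a b c. \<mu> (\<alpha> a) (\<mu> b c) = \<mu> (\<mu> a b) (\<alpha> c)"
    using assms by (auto simp: hom_associative_algebra_def)
  note add = additive_bilinear_map[OF \<mu>]
  have "fps_bilinear \<mu> (fps_linear \<alpha> a) (fps_bilinear \<mu> b c) =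
      fps_bilinear \<mu> (fps_bilinear \<mu> a b) (fps_linear \<alpha> c)" for a b c
    unfolding fps_bilinear_linear1 fps_bilinear_linear2
    by (rule fps_bilinear_assoc[symmetric]) (simp_all add: assoc add)
  then show ?thesis
    unfolding hom_associative_algebra_def
    by (simp add: module_fps[OF m] fps_bilinear_bilinear_map[OF \<mu>] fps_linear_module_hom[OF \<alpha>]
        fps_linear_bilinear[OF additive_module_hom[OF \<alpha>]] fps_bilinear_linear1 fps_bilinear_linear2
        mult)
qed

lemma hom_bimodule_fps:
  assumes "hom_bimodule sA \<mu> \<alpha> sM l r \<phi>"
  shows "hom_bimodule (fps_bilinear sA) (fps_bilinear \<mu>) (fps_linear \<alpha>)
    (fps_bilinear sM) (fps_bilinear l) (fps_bilinear r) (fps_linear \<phi>)"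
proof -
  have m: "module sM" and \<phi>: "module_hom sM sM \<phi>"
    and l: "bilinear_map sA sM sM l" and r: "bilinear_map sM sA sM r"
    and eqs: "\<And>x v. \<phi> (l x v) = l (\<alpha> x) (\<phi> v)" "\<And>x v. \<phi> (r v x) = r (\<phi> v) (\<alpha> x)"
    and ll: "\<And>x y v. l (\<mu> x y) (\<phi> v) = l (\<alpha> x) (l y v)"
    and rr: "\<And>x y v. r (\<phi> v) (\<mu> x y) = r (r v x) (\<alpha> y)"
    and lr: "\<And>x y v. l (\<alpha> x) (r v y) = r (l x v) (\<alpha> y)"
    using assms by (auto simp: hom_bimodule_def)
  note add = additive_bilinear_map[OF l] additive_bilinear_map[OF r]
  have 1: "fps_bilinear l (fps_bilinear \<mu> x y) (fps_linear \<phi> v) =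
      fps_bilinear l (fps_linear \<alpha> x) (fps_bilinear l y v)" for x y v
    unfolding fps_bilinear_linear1 fps_bilinear_linear2
    by (rule fps_bilinear_assoc) (simp_all add: ll add)
  have 2: "fps_bilinear r (fps_linear \<phi> v) (fps_bilinear \<mu> x y) =
      fps_bilinear r (fps_bilinear r v x) (fps_linear \<alpha> y)" for x y v
    unfolding fps_bilinear_linear1 fps_bilinear_linear2
    by (rule fps_bilinear_assoc[symmetric]) (simp_all add: rr add)
  have 3: "fps_bilinear l (fps_linear \<alpha> x) (fps_bilinear r v y) =
      fps_bilinear r (fps_bilinear l x v) (fps_linear \<alpha> y)" for x y v
    unfolding fps_bilinear_linear1 fps_bilinear_linear2
    by (rule fps_bilinear_assoc[symmetric]) (simp_all add: lr add)
  show ?thesis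
    unfolding hom_bimodule_def
    by (simp add: module_fps[OF m] fps_bilinear_bilinear_map[OF l] fps_bilinear_bilinear_map[OF r]
        fps_linear_module_hom[OF \<phi>] 1 2 3)
       (simp add: fps_linear_bilinear[OF additive_module_hom[OF \<phi>]]
        fps_bilinear_linear1 fps_bilinear_linear2 eqs)
qed

end

theory Submission
  imports Defs
begin

text \<open>
  Applied to constant series \<open>u, v \<in> M \<subseteq> M[[t]]\<close>, the O-operator identity for
  \<open>T\<^sub>t = T + t T\<^sub>1 + \<dots>\<close> is an equation between two power series over \<open>A\<close>, hence a family of equations
  in \<open>A\<close>, one for each power of \<open>t\<close> (\<open>formal_deformation_coefficients\<close>). The constant
  term is the O-operator identity for \<open>T\<close>; the coefficient of \<open>t\<close> is its linearisation at \<open>T\<close> in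
  the direction \<open>T\<^sub>1\<close>:
  \<open>T u \<cdot> T\<^sub>1 v + T\<^sub>1 u \<cdot> T v = T (l (T\<^sub>1 u) v + r u (T\<^sub>1 v)) + T\<^sub>1 (l (T u) v + r u (T v))\<close>.
  Since \<open>T\<close> is additive, the difference of the two sides is the coboundary of \<open>T\<^sub>1\<close> at \<open>(u, v)\<close>.
\<close>

lemma fps_family_const_nth:
  assumes "\<And>i. Modules.additive (T i)"
  shows "fps_family T (fps_const u) $ n = T n u"
proof -
  have "(\<Sum>i=0..n. T i (fps_const u $ (n - i))) = (\<Sum>i=0..n. if i = n then T n u else 0)"
    by (rule sum.cong) (auto simp: additive.zero[OF assms])
  then show ?thesis
    by (simp add: fps_family_def)
qed

lemma fps_bilinear_const_right_nth:
  assumes "\<And>x. Modules.additive (\<beta> x)"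
  shows "fps_bilinear \<beta> a (fps_const v) $ n = \<beta> (a $ n) v"
proof -
  have "(\<Sum>i=0..n. \<beta> (a $ i) (fps_const v $ (n - i))) = (\<Sum>i=0..n. if i = n then \<beta> (a $ n) v else 0)"
    by (rule sum.cong) (auto simp: additive.zero[OF assms])
  then show ?thesis
    by (simp add: fps_bilinear_def)
qed

lemma fps_bilinear_const_left_nth:
  assumes "\<And>y. Modules.additive (\<lambda>x. \<beta> x y)"
  shows "fps_bilinear \<beta> (fps_const u) b $ n = \<beta> u (b $ n)"
  unfolding fps_bilinear_flip[of \<beta>] by (rule fps_bilinear_const_right_nth) (rule assms)

text \<open>
  On constant series the product \<open>l (T\<^sub>t u) v + r u (T\<^sub>t v)\<close> inside \<open>T\<^sub>t\<close> is itself a series in \<open>t\<close>, with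
  \<open>n\<close>-th coefficient the product induced by \<open>T\<^sub>n\<close>. So both sides of the O-operator identity become
  Cauchy products.
\<close>

lemma formal_deformation_coefficients:
  assumes bim: "hom_bimodule sA \<mu> \<alpha> sM l r \<phi>"
    and def: "formal_deformation sA \<mu> \<alpha> sM l r \<phi> T Ti"
  shows "(\<Sum>i=0..n. \<mu> (Ti i u) (Ti (n - i) v)) =
    (\<Sum>i=0..n. Ti i (induced_product l r (Ti (n - i)) u v))"
proof -
  have add: "Modules.additive (Ti i)" for i
    using def by (auto simp: formal_deformation_def cochains1_def intro: additive_module_hom)
  have l: "bilinear_map sA sM sM l" and r: "bilinear_map sM sA sM r"
    using bim by (auto simp: hom_bimodule_def)
  let ?T = "fps_family Ti"
  have "fps_bilinear \<mu> (?T (fps_const u)) (?T (fps_const v)) =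
      ?T (fps_bilinear l (?T (fps_const u)) (fps_const v)
        + fps_bilinear r (fps_const u) (?T (fps_const v)))"
    using def by (simp add: formal_deformation_def O_operator_def)
  then have "fps_bilinear \<mu> (?T (fps_const u)) (?T (fps_const v)) $ n =
      ?T (fps_bilinear l (?T (fps_const u)) (fps_const v)
        + fps_bilinear r (fps_const u) (?T (fps_const v))) $ n"
    by simp
  moreover have "(fps_bilinear l (?T (fps_const u)) (fps_const v)
        + fps_bilinear r (fps_const u) (?T (fps_const v))) $ k = induced_product l r (Ti k) u v" for k
    by (simp add: induced_product_def fps_family_const_nth[OF add]
        fps_bilinear_const_right_nth[OF additive_bilinear_map(1)[OF l]]
        fps_bilinear_const_left_nth[OF additive_bilinear_map(2)[OF r]])
  ultimately show ?thesis
    by (simp add: fps_bilinear_def[of \<mu>] fps_family_const_nth[OF add])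
       (simp add: fps_family_def)
qed

theorem proposition4p13:
  fixes sA :: "'k::field \<Rightarrow> 'a::ab_group_add \<Rightarrow> 'a"
    and \<mu> :: "'a \<Rightarrow> 'a \<Rightarrow> 'a" and \<alpha> :: "'a \<Rightarrow> 'a"
    and sM :: "'k \<Rightarrow> 'm::ab_group_add \<Rightarrow> 'm"
    and l :: "'a \<Rightarrow> 'm \<Rightarrow> 'm" and r :: "'m \<Rightarrow> 'a \<Rightarrow> 'm" and \<phi> :: "'m \<Rightarrow> 'm"
    and T :: "'m \<Rightarrow> 'a" and Ti :: "nat \<Rightarrow> 'm \<Rightarrow> 'a"
  assumes "hom_associative_algebra sA \<mu> \<alpha>"
    and "hom_bimodule sA \<mu> \<alpha> sM l r \<phi>"
    and "O_operator sA \<mu> \<alpha> sM l r \<phi> T"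
    and "formal_deformation sA \<mu> \<alpha> sM l r \<phi> T Ti"
  shows "O_cocycle1 sA \<mu> \<alpha> sM l r \<phi> T (Ti 1) \<and>
    (\<forall>u v. \<mu> (T u) (Ti 1 v) + \<mu> (Ti 1 u) (T v)
      - T (r u (Ti 1 v) + l (Ti 1 u) v)
      - Ti 1 (r u (T v) + l (T u) v) = 0)"
proof -
  have T0: "Ti 0 = T" and T1: "Ti 1 \<in> cochains1 sA \<alpha> sM \<phi>"
    using assms(4) by (auto simp: formal_deformation_def)
  have add: "T (x + y) = T x + T y" for x y
    using assms(3) by (auto simp: O_operator_def module_hom_iff)
  have lin: "\<mu> (T u) (Ti 1 v) + \<mu> (Ti 1 u) (T v) =
      T (induced_product l r (Ti 1) u v) + Ti 1 (induced_product l r T u v)" for u v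
    using formal_deformation_coefficients[OF assms(2,4), where n = 1 and u = u and v = v] by (simp add: T0)
  have "O_coboundary1 \<mu> l r T (Ti 1) u v = 0" for u v
    using lin[of u v]
    by (simp add: O_coboundary1_def induced_left_def induced_right_def induced_product_def add
        algebra_simps)
  moreover have "\<mu> (T u) (Ti 1 v) + \<mu> (Ti 1 u) (T v)
      - T (r u (Ti 1 v) + l (Ti 1 u) v) - Ti 1 (r u (T v) + l (T u) v) = 0" for u v
    using lin[of u v] by (simp add: induced_product_def add.commute)
  ultimately show ?thesis
    using T1 by (simp add: O_cocycle1_def)
qed

end
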